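(* Let $I\subset\mathbb{R}$ be a nondegenerate compact interval, let $p,d\in\mathbb{N}$, let $(\Omega,\mathcal{A},\mathbb{P})$ be a probability space, let $\xi:\Omega\to\mathbb{R}^d$ be a $d$-dimensional random variable, and let $f:I^p\times\mathbb{R}^d\to I$ be a $(\mathcal{B}(I^p)\times\mathcal{B}(\mathbb{R}^d),\mathcal{B}(I))$-measurable map such that for each $y\in\mathbb{R}^d$ the map $I^p\ni x\mapsto f(x,y)$ is in $\mathcal{M}_p$. Then the map $M:\Omega\to\mathcal{M}_p$ given by $$(M(\omega))(x):=f(x,\xi(\omega)),\qquad \omega\in\Omega,\ x\in I^p,$$ is a random mean generated by $\xi$.
   Context: $\mathbb{N}$ is the set of positive integers. A nondegenerate interval is one containing at least two distinct points. $\mathcal{B}(\cdot)$ denotes the Borel $\sigma$-algebra; $\mathcal{B}(I^p)\times\mathcal{B}(\mathbb{R}^d)$ is the product $\sigma$-algebra. $\mathcal{C}(I^p)$ is the Banach space of real-valued continuous functions on $I^p$ with the supremum norm. $\mathcal{M}_p\subset\mathcal{C}(I^p)$ is the set of $p$-variable (continuous) means on $I$: those $m\in\mathcal{C}(I^p)$ with $\min(x)\le m(x)\le\max(x)$ for all $x\in I^p$, where $\min(x)$ and $\max(x)$ are the minimum and maximum of the coordinates of $x$. Definition (random mean generated by $\xi$). Let $\xi:\Omega\to\mathbb{R}^d$ be a random variable on $(\Omega,\mathcal{A},\mathbb{P})$. A map $M:\Omega\to\mathcal{M}_p$ is called a ($p$-variable, continuous) random mean (in $I$) generated by $\xi$ if: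 (i) $M$ is $(\mathcal{A},\mathcal{B}(\mathcal{C}(I^p)))$-measurable; and (ii) there is a $(\mathcal{B}(I^p)\times\mathcal{B}(\mathbb{R}^d),\mathcal{B}(I))$-measurable map $M_\xi:I^p\times\mathbb{R}^d\to I$ such that (a) for every $\omega\in\Omega$ the map $I^p\ni x\mapsto M_\xi(x,\xi(\omega))$ is in $\mathcal{C}(I^p)$, and (b) $\mathbb{P}(\{\omega\in\Omega:(M(\omega))(x)=M_\xi(x,\xi(\omega))\text{ for every }x\in I^p\})=1$. *)

theory Defs
  imports "HOL-Probability.Probability"
begin

definition nondegenerate_compact_interval :: "real set \<Rightarrow> bool" where
  "nondegenerate_compact_interval I \<longleftrightarrow>
     is_interval I \<and> compact I \<and> (\<exists>x\<in>I. \<exists>y\<in>I. x \<noteq> y)"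

(* The p-fold power of I; the exponent is the cardinality of the index type. *)
definition cube :: "real set \<Rightarrow> (real^'p::finite) set" where
  "cube I = {x. \<forall>i. x $ i \<in> I}"

(* The Banach space of continuous real functions on cube I, as a metric space.
   Its elements are represented by functions on the whole type that are
   undefined outside cube I, so that equality of elements is equality on cube I.
   The library's cfunspace consists of bounded continuous functions; boundedness
   is automatic for compact I, see mspace_Cfun below. *)
definition Cfun :: "real set \<Rightarrow> ((real^'p::finite) \<Rightarrow> real) metric" where
  "Cfun I = cfunspace (top_of_set (cube I)) euclidean_metric"

definition borel_Cfun :: "real set \<Rightarrow> ((real^'p::finite) \<Rightarrow> real) measure" where
  "borel_Cfun I = sigma (mspace (Cfun I)) {U. openin (mtopology_of (Cfun I)) U}"

definition means :: "real set \<Rightarrow> ((real^'p::finite) \<Rightarrow> real) set" where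
  "means I = {m \<in> mspace (Cfun I).
     \<forall>x\<in>cube I. Min (range (($) x)) \<le> m x \<and> m x \<le> Max (range (($) x))}"

(* M is relevant on space P only. The set in the last conjunct is not assumed to be
   measurable: since measure P vanishes on non-measurable sets, the equation
   includes its measurability. *)
definition random_mean ::
  "real set \<Rightarrow> 'w measure \<Rightarrow> ('w \<Rightarrow> real^'d::finite) \<Rightarrow> ('w \<Rightarrow> (real^'p::finite) \<Rightarrow> real) \<Rightarrow> bool"
where
  "random_mean I P \<xi> M \<longleftrightarrow>
     M \<in> space P \<rightarrow> means I \<and>
     M \<in> P \<rightarrow>\<^sub>M borel_Cfun I \<and>
     (\<exists>M\<xi> \<in> (restrict_space borel (cube I) \<Otimes>\<^sub>M borel) \<rightarrow>\<^sub>M restrict_space borel I.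
        (\<forall>\<omega>\<in>space P. (\<lambda>x\<in>cube I. M\<xi> (x, \<xi> \<omega>)) \<in> mspace (Cfun I)) \<and>
        measure P {\<omega> \<in> space P. \<forall>x\<in>cube I. M \<omega> x = M\<xi> (x, \<xi> \<omega>)} = 1)"

lemma compact_cube:
  assumes "compact I"
  shows "compact (cube I :: (real^'p::finite) set)"
proof -
  have "bounded (cube I :: (real^'p) set)"
  proof -
    obtain B where B: "\<And>t. t \<in> I \<Longrightarrow> \<bar>t\<bar> \<le> B"
      using compact_imp_bounded[OF assms] by (auto simp: bounded_iff)
    have "norm x \<le> (\<Sum>i\<in>(UNIV::'p set). B)" if "x \<in> cube I" for x :: "real^'p"
      using that by (intro order_trans[OF norm_le_l1_cart] sum_mono) (auto simp: cube_def B)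
    then show ?thesis by (auto simp: bounded_iff)
  qed
  moreover have "closed (cube I :: (real^'p) set)"
  proof -
    have "cube I = (\<Inter>i. (\<lambda>x::real^'p. x $ i) -` I)" by (auto simp: cube_def)
    then show ?thesis
      using compact_imp_closed[OF assms] by (auto intro!: closed_INT closed_vimage continuous_intros)
  qed
  ultimately show ?thesis by (simp add: compact_eq_bounded_closed)
qed

lemma mspace_Cfun:
  assumes "compact I"
  shows "mspace (Cfun I) = {g. g \<in> extensional (cube I) \<and> continuous_on (cube I) g}"
proof -
  have "compactin (top_of_set (cube I)) (topspace (top_of_set (cube I)))"
    using compact_cube[OF assms] by (simp add: compactin_subtopology)
  from compactin_mspace_cfunspace[OF this, of "euclidean_metric :: real metric"]
  show ?thesis unfolding Cfun_def by auto
qed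

lemma mdist_Cfun:
  fixes g h :: "real^'p::finite \<Rightarrow> real"
  assumes "g \<in> mspace (Cfun I)" "h \<in> mspace (Cfun I)" "(cube I :: (real^'p) set) \<noteq> {}"
  shows "mdist (Cfun I) g h = (SUP x\<in>cube I. \<bar>g x - h x\<bar>)"
  using assms
  by (simp add: Cfun_def mdist_cfunspace_eq_mdist_funspace Met_TC.fdist_def Met_TC.fspace_def
      image_subset_iff dist_real_def)

end

theory Submission
  imports Defs
begin

text \<open>
  Only measurability into the Borel sets of the function space needs an argument. By compactness,
  for a continuous function \<open>g\<close> in an open set \<open>U\<close> there are finitely many basic open sets that
  cover the compact domain and rational bounds for \<open>g\<close> on each of them such that every function
  obeying these bounds is in \<open>U\<close>. There are countably many choices of such data, so \<open>U\<close> is a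
  countable union of sets of functions that obey finitely many bounds. By continuity a bound needs
  to be tested only on a countable dense set, hence the preimage of \<open>U\<close> is measurable.
\<close>

text \<open>The bounds are rational so that, with the sets \<open>B\<close> taken from a countable
  basis, there are only countably many finite \<open>S\<close>. They are non-strict so that they
  survive limits. The sets \<open>B\<close> are open in the whole space, hence the intersection with
  \<open>K\<close>.\<close>

definition banded ::
  "'a::topological_space set \<Rightarrow> ('a set \<times> rat \<times> rat) set \<Rightarrow> ('a \<Rightarrow> real) \<Rightarrow> bool" where
  "banded K S h \<longleftrightarrow> (\<forall>(B, a, b)\<in>S. \<forall>x\<in>B \<inter> K. real_of_rat a \<le> h x \<and> h x \<le> real_of_rat b)"

text \<open>Openness of \<open>B\<close> is the point: it makes every point of
  \<open>B \<inter> K\<close> a limit of points of \<open>B \<inter> D\<close>, not merely of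
  \<open>D\<close>. The closed interval from \<open>a\<close> to \<open>b\<close> then keeps the
  limit of the values of \<open>h\<close>.\<close>

lemma continuous_on_bounds_from_dense:
  fixes h :: "'a::metric_space \<Rightarrow> real"
  assumes "continuous_on K h" "open B" "D \<subseteq> K" "K \<subseteq> closure D"
    and D: "\<And>x. x \<in> B \<inter> D \<Longrightarrow> a \<le> h x \<and> h x \<le> b"
    and "x \<in> B \<inter> K"
  shows "a \<le> h x \<and> h x \<le> b"
proof -
  have "x \<in> closure (B \<inter> D)"
    using open_Int_closure_subset[OF assms(2), of D] assms(4,6) by blast
  then obtain s where s: "\<And>n. s n \<in> B \<inter> D" "s \<longlonglongrightarrow> x"
    unfolding closure_sequential by blast
  have "(\<lambda>n. h (s n)) \<longlonglongrightarrow> h x"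
    using continuous_on_tendsto_compose[OF assms(1) s(2)] s(1) assms(3,6)
    by (auto simp: subset_iff)
  moreover have "\<forall>n. h (s n) \<in> {a..b}"
    using D s(1) by simp
  moreover have "closed {a..b}" by simp
  ultimately have "h x \<in> {a..b}"
    using closed_sequentially[of "{a..b}" "\<lambda>n. h (s n)"] by blast
  then show ?thesis by simp
qed

text \<open>Near each point of \<open>K\<close>, continuity confines \<open>g\<close> between two
  rationals at most \<open>r\<close> apart on a basic open set, and by compactness finitely many of
  these sets cover \<open>K\<close>. A function \<open>h\<close> with the same bounds lies, at each
  point, in an interval of length at most \<open>r\<close> that also contains the value of
  \<open>g\<close>.\<close>

lemma banded_neighbourhood:
  fixes K :: "'a::metric_space set"
  assumes "compact K" "continuous_on K g" "topological_basis \<B>" "0 < r"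
  obtains S where "finite S" "S \<subseteq> \<B> \<times> UNIV" "banded K S g"
    "\<And>h x. banded K S h \<Longrightarrow> x \<in> K \<Longrightarrow> \<bar>g x - h x\<bar> \<le> r"
proof -
  have "\<exists>B a b. B \<in> \<B> \<and> x \<in> B \<and>
      (\<forall>y\<in>B \<inter> K. real_of_rat a \<le> g y \<and> g y \<le> real_of_rat b) \<and> real_of_rat b - real_of_rat a \<le> r"
    if "x \<in> K" for x
  proof -
    \<comment> \<open>Both rationals are chosen within \<open>r / 2\<close> of \<open>g x\<close>,
      on either side, so their difference is below \<open>r\<close>.\<close>
    obtain a where a: "g x - r / 2 < real_of_rat a" "real_of_rat a < g x"
      using of_rat_dense[of "g x - r / 2" "g x"] assms(4) by auto
    obtain b where b: "g x < real_of_rat b" "real_of_rat b < g x + r / 2"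
      using of_rat_dense[of "g x" "g x + r / 2"] assms(4) by auto
    obtain V where V: "open V" "V \<inter> K = g -` {real_of_rat a<..<real_of_rat b} \<inter> K"
      using assms(2) unfolding continuous_on_open_invariant by (meson open_greaterThanLessThan)
    moreover have "x \<in> V" using V a b that by auto
    ultimately obtain B where "B \<in> \<B>" "x \<in> B" "B \<subseteq> V"
      using topological_basisE[OF assms(3)] by metis
    moreover have "real_of_rat a \<le> g y \<and> g y \<le> real_of_rat b" if "y \<in> B \<inter> K" for y
    proof -
      have "y \<in> V \<inter> K" using \<open>B \<subseteq> V\<close> that by blast
      then show ?thesis unfolding V(2) by auto
    qed
    ultimately show ?thesis using a b by (intro exI[of _ B] exI[of _ a] exI[of _ b]) auto
  qed
  then obtain B a b where *: "\<And>x. x \<in> K \<Longrightarrow> B x \<in> \<B>" "\<And>x. x \<in> K \<Longrightarrow> x \<in> B x"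
    "\<And>x y. x \<in> K \<Longrightarrow> y \<in> B x \<inter> K \<Longrightarrow> real_of_rat (a x) \<le> g y \<and> g y \<le> real_of_rat (b x)"
    "\<And>x. x \<in> K \<Longrightarrow> real_of_rat (b x) - real_of_rat (a x) \<le> r"
    by metis
  obtain C where C: "C \<subseteq> K" "finite C" "K \<subseteq> (\<Union>x\<in>C. B x)"
    using compactE_image[OF assms(1), of K B] *(1,2) topological_basis_open[OF assms(3)] by blast
  show thesis
  proof
    let ?S = "(\<lambda>x. (B x, a x, b x)) ` C"
    show "finite ?S" "?S \<subseteq> \<B> \<times> UNIV" using C *(1) by auto
    show g: "banded K ?S g" using C(1) *(3) by (fastforce simp: banded_def)
    fix h x assume h: "banded K ?S h" and "x \<in> K"
    then obtain c where c: "c \<in> C" "x \<in> B c" using C(3) by blast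
    \<comment> \<open>Stated for arbitrary \<open>u\<close> because it is applied to both
      \<open>h\<close> and \<open>g\<close>.\<close>
    have "real_of_rat (a c) \<le> u x \<and> u x \<le> real_of_rat (b c)" if "banded K ?S u" for u
      using that c \<open>x \<in> K\<close> by (auto simp: banded_def)
    from this[OF h] this[OF g] *(4)[of c] show "\<bar>g x - h x\<bar> \<le> r"
      using c(1) C(1) by auto
  qed
qed

lemma continuous_on_mspace_cfunspace:
  assumes "h \<in> mspace (cfunspace (top_of_set K) (euclidean_metric :: 'b::metric_space metric))"
  shows "continuous_on K h"
  using assms by simp

text \<open>Every \<open>g\<close> in \<open>U\<close> is the centre of a ball inside
  \<open>U\<close>, and suitable bounds around \<open>g\<close> admit only functions from that ball.
  Indexing by all admissible \<open>S\<close>, not by the points of \<open>U\<close>, makes the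
  union countable once \<open>\<B>\<close> is countable.\<close>

lemma openin_cfunspace_countable_union:
  fixes K :: "'a::metric_space set" and U :: "('a \<Rightarrow> real) set"
  defines "C \<equiv> cfunspace (top_of_set K) euclidean_metric"
  assumes K: "compact K" and \<B>: "topological_basis \<B>" and U: "openin (mtopology_of C) U"
  shows "U = (\<Union>S\<in>{S. finite S \<and> S \<subseteq> \<B> \<times> UNIV \<and> {h \<in> mspace C. banded K S h} \<subseteq> U}.
    {h \<in> mspace C. banded K S h})" (is "U = ?V")
proof
  show "U \<subseteq> ?V"
  proof
    fix g assume "g \<in> U"
    then obtain r where r: "0 < r" "mball_of C g r \<subseteq> U"
      using U Metric_space.openin_mtopology[OF Metric_space_mspace_mdist]
      unfolding mtopology_of_def mball_of_def by metis
    have g: "g \<in> mspace C"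
      using openin_subset[OF U] \<open>g \<in> U\<close> by (auto simp del: mspace_cfunspace simp: C_def)
    have "continuous_on K g"
      using g unfolding C_def by (rule continuous_on_mspace_cfunspace)
    \<comment> \<open>Pointwise bounds give only a non-strict bound on the supremum distance;
      \<open>r / 2\<close> leaves room for the strict inequality of the open ball.\<close>
    then obtain S where S: "finite S" "S \<subseteq> \<B> \<times> UNIV" "banded K S g"
      "\<And>h x. banded K S h \<Longrightarrow> x \<in> K \<Longrightarrow> \<bar>g x - h x\<bar> \<le> r / 2"
      using banded_neighbourhood[OF K _ \<B>, of g "r / 2"] r(1) by auto
    have "h \<in> U" if h: "h \<in> mspace C" "banded K S h" for h
    proof -
      have "mdist C g h \<le> r / 2"
        unfolding C_def using S(4)[OF h(2)] r(1)
        by (intro mdist_cfunspace_le) (auto simp: dist_real_def)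
      then have "h \<in> mball_of C g r" using r(1) g h(1) by simp
      then show ?thesis using r(2) by blast
    qed
    then have "{h \<in> mspace C. banded K S h} \<subseteq> U" by blast
    then show "g \<in> ?V" using S(1-3) g by blast
  qed
  show "?V \<subseteq> U" by (rule UN_least) simp
qed

text \<open>This reduces Borel measurability in the function space to measurability of the
  evaluations: preimages of open sets suffice, and each is a countable union of sets described by
  countably many evaluations.\<close>

lemma measurable_borel_cfunspace:
  fixes K :: "'a::{metric_space, second_countable_topology} set" and M :: "'w \<Rightarrow> 'a \<Rightarrow> real"
  defines "C \<equiv> cfunspace (top_of_set K) euclidean_metric"
  assumes K: "compact K"
    and M: "M \<in> space P \<rightarrow> mspace C"
    and meas: "\<And>x. x \<in> K \<Longrightarrow> (\<lambda>\<omega>. M \<omega> x) \<in> borel_measurable P"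
  shows "M \<in> P \<rightarrow>\<^sub>M sigma (mspace C) {U. openin (mtopology_of C) U}"
proof (rule measurable_measure_of)
  show "{U. openin (mtopology_of C) U} \<subseteq> Pow (mspace C)"
    using openin_subset[of "mtopology_of C"] by auto
  show "M \<in> space P \<rightarrow> mspace C" by fact
  fix U assume "U \<in> {U. openin (mtopology_of C) U}"
  then have U: "openin (mtopology_of C) U" by simp
  obtain \<B> :: "'a set set" where \<B>: "countable \<B>" "topological_basis \<B>"
    using ex_countable_basis by blast
  \<comment> \<open>\<open>D\<close> must lie inside \<open>K\<close>, since the evaluations are
    known to be measurable only at points of \<open>K\<close>.\<close>
  obtain D where D: "countable D" "D \<subseteq> K" "K \<subseteq> closure D"
    using separable by blast
  define band where "band S = {h \<in> mspace C. banded K S h}" for S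
  define \<S> where "\<S> = {S. finite S \<and> S \<subseteq> \<B> \<times> UNIV \<and> band S \<subseteq> U}"
  have "countable \<S>"
  proof (rule countable_subset)
    show "\<S> \<subseteq> {S. finite S \<and> S \<subseteq> \<B> \<times> UNIV}" by (auto simp: \<S>_def)
    show "countable {S. finite S \<and> S \<subseteq> \<B> \<times> (UNIV :: (rat \<times> rat) set)}"
      using \<B>(1) by (intro countable_Collect_finite_subset) auto
  qed
  have preimage_band: "M -` band S \<inter> space P \<in> sets P" if "S \<in> \<S>" for S
  proof -
    \<comment> \<open>The bounds of \<open>banded\<close>, tested on \<open>D\<close> in place of
      \<open>K\<close>: the uncountable quantifier becomes a countable one.\<close>
    let ?Q = "\<lambda>\<omega>. \<forall>T\<in>S. \<forall>x\<in>fst T \<inter> D.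
      real_of_rat (fst (snd T)) \<le> M \<omega> x \<and> M \<omega> x \<le> real_of_rat (snd (snd T))"
    have "M \<omega> \<in> band S \<longleftrightarrow> ?Q \<omega>" if "\<omega> \<in> space P" for \<omega>
    proof
      assume "M \<omega> \<in> band S"
      then have *: "banded K S (M \<omega>)" by (simp add: band_def)
      show "?Q \<omega>"
      proof (intro ballI)
        fix T x assume "T \<in> S" "x \<in> fst T \<inter> D"
        then have "x \<in> fst T \<inter> K" using D(2) by blast
        with bspec[OF *[unfolded banded_def] \<open>T \<in> S\<close>]
        show "real_of_rat (fst (snd T)) \<le> M \<omega> x \<and> M \<omega> x \<le> real_of_rat (snd (snd T))"
          by (simp only: case_prod_beta)
      qed
    next
      assume Q: "?Q \<omega>"
      have M\<omega>: "M \<omega> \<in> mspace C" using M that by blast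
      then have cont: "continuous_on K (M \<omega>)"
        unfolding C_def by (rule continuous_on_mspace_cfunspace)
      have "banded K S (M \<omega>)"
        unfolding banded_def
      proof clarify
        fix B a b x assume T: "(B, a, b) \<in> S" "x \<in> B" "x \<in> K"
        have "open B"
          using \<open>S \<in> \<S>\<close> T(1) topological_basis_open[OF \<B>(2)] by (auto simp: \<S>_def)
        moreover have "real_of_rat a \<le> M \<omega> y \<and> M \<omega> y \<le> real_of_rat b" if "y \<in> B \<inter> D" for y
          using Q[rule_format, OF T(1), of y] that by simp
        ultimately show "real_of_rat a \<le> M \<omega> x \<and> M \<omega> x \<le> real_of_rat b"
          using continuous_on_bounds_from_dense[OF cont _ D(2,3)] T(2,3) by blast
      qed
      then show "M \<omega> \<in> band S" using M\<omega> by (simp add: band_def)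
    qed
    then have "M -` band S \<inter> space P = {\<omega> \<in> space P. ?Q \<omega>}" by blast
    also have "\<dots> \<in> sets P"
    proof -
      have pred: "Measurable.pred P (\<lambda>\<omega>. a \<le> M \<omega> x \<and> M \<omega> x \<le> b)" if "x \<in> D" for a b x
      proof -
        have [measurable]: "(\<lambda>\<omega>. M \<omega> x) \<in> borel_measurable P" using meas D(2) that by blast
        show ?thesis by measurable
      qed
      have "finite S" using that by (simp add: \<S>_def)
      \<comment> \<open>One set \<open>B\<close> gives a countable conjunction of measurable
        conditions; the finitely many members of \<open>S\<close> are then combined.\<close>
      moreover have "Measurable.pred P (\<lambda>\<omega>. \<forall>x\<in>B \<inter> D. a \<le> M \<omega> x \<and> M \<omega> x \<le> b)" for B a b
        using countable_Int2[OF D(1)] pred by (intro measurable_pred_countable(1)) auto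
      ultimately have "Measurable.pred P ?Q"
        by (rule pred_intros_finite(3))
      then show ?thesis unfolding pred_def .
    qed
    finally show ?thesis .
  qed
  have "M -` U \<inter> space P = (\<Union>S\<in>\<S>. M -` band S \<inter> space P)"
  proof -
    have "U = (\<Union>S\<in>\<S>. band S)"
      unfolding \<S>_def band_def C_def
      by (rule openin_cfunspace_countable_union[OF K \<B>(2) U[unfolded C_def]])
    then have "M -` U = (\<Union>S\<in>\<S>. M -` band S)" by (simp add: vimage_UN)
    then show ?thesis by blast
  qed
  also have "\<dots> \<in> sets P"
    using \<open>countable \<S>\<close> preimage_band by (rule sets.countable_UN'')
  finally show "M -` U \<inter> space P \<in> sets P" .
qed

theorem theorem2p4:
  fixes I :: "real set"
    and P :: "'w measure"
    and \<xi> :: "'w \<Rightarrow> real^'d::finite"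
    and f :: "(real^'p::finite) \<times> (real^'d) \<Rightarrow> real"
  assumes "nondegenerate_compact_interval I"
    and "prob_space P"
    and "\<xi> \<in> P \<rightarrow>\<^sub>M borel"
    and "f \<in> (restrict_space borel (cube I) \<Otimes>\<^sub>M borel) \<rightarrow>\<^sub>M restrict_space borel I"
    and "\<And>y. (\<lambda>x\<in>cube I. f (x, y)) \<in> means I"
  shows "random_mean I P \<xi> (\<lambda>\<omega>. \<lambda>x\<in>cube I. f (x, \<xi> \<omega>))"
proof -
  have I: "compact I"
    using assms(1) by (auto simp: nondegenerate_compact_interval_def)
  have C: "(\<lambda>x\<in>cube I. f (x, y)) \<in> mspace (Cfun I)" for y
    using assms(5) by (simp add: means_def)
  \<comment> \<open>With \<open>x\<close> fixed, this is joint measurability of \<open>f\<close>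
    composed with the measurable map \<open>\<omega> \<mapsto> (x, \<xi> \<omega>)\<close>.\<close>
  have "(\<lambda>\<omega>. f (x, \<xi> \<omega>)) \<in> borel_measurable P" if "x \<in> cube I" for x
  proof -
    have "(\<lambda>\<omega>. (x, \<xi> \<omega>)) \<in> P \<rightarrow>\<^sub>M restrict_space borel (cube I) \<Otimes>\<^sub>M borel"
      using that by (intro measurable_Pair assms(3) measurable_const) (simp add: space_restrict_space)
    from measurable_compose[OF this assms(4)] show ?thesis
      by (simp add: measurable_restrict_space2_iff)
  qed
  then have "(\<lambda>\<omega>. \<lambda>x\<in>cube I. f (x, \<xi> \<omega>)) \<in> P \<rightarrow>\<^sub>M borel_Cfun I"
    using C unfolding borel_Cfun_def Cfun_def
    by (intro measurable_borel_cfunspace compact_cube I) (auto simp del: mspace_cfunspace)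
  \<comment> \<open>The map \<open>M\<xi>\<close> is \<open>f\<close> itself, so the two sides agree
    for every \<open>\<omega>\<close> and the set is all of \<open>space P\<close>.\<close>
  moreover have "measure P {\<omega> \<in> space P. \<forall>x\<in>cube I. (\<lambda>x\<in>cube I. f (x, \<xi> \<omega>)) x = f (x, \<xi> \<omega>)} = 1"
    using prob_space.prob_space[OF assms(2)] by simp
  ultimately show ?thesis
    unfolding random_mean_def using assms(4,5) C by blast
qed

end
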